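(* The spectral representation formula for killed Brownian motion, i.e. the identity $$\frac{1}{2}\frac{1}{\sqrt{2\pi t}}\sum_{n=-\infty}^{\infty}\left(e^{-\frac{(x-y+4n)^2}{2t}}-e^{-\frac{(x+y+4n+2)^2}{2t}}\right)=\frac12\sum_{n=1}^{\infty}e^{-\frac{n^2\pi^2}{8}t}\sin\left(\frac{n\pi(x+1)}{2}\right)\sin\left(\frac{n\pi(y+1)}{2}\right)$$ for all $x,y\in\mathbb{R}$ and $t>0$, implies the second modular identity: for all $t>0$ and $z\in\mathbb{C}$, $$\sqrt{t}\sum_{n\in\mathbb{Z}}e^{-\pi t(n+\frac12)^2}\cos\left((2n+1)z\right)=e^{-\frac{z^2}{\pi t}}\sum_{n\in\mathbb{Z}}(-1)^n e^{-\frac{\pi n^2}{t}}\cosh\left(2n\frac{z}{t}\right)=\sum_{n\in\mathbb{Z}}(-1)^n e^{-\frac{(z+\pi n)^2}{\pi t}}.$$ *)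

theory Defs
  imports "HOL-Analysis.Analysis"
begin

end

theory Submission imports Defs "HOL-Complex_Analysis.Complex_Analysis" begin

text \<open>Put y = 0 and t := 2t/\<pi>, x := 2z/\<pi> in the spectral representation. The two families of images
  merge into a single alternating sum, while only the odd frequencies survive on the spectral side,
  which gives the identity for real z. Both sides are entire in z, so it extends to complex z.\<close>

section \<open>Splitting and pairing infinite sums\<close>

text \<open>Summability passes to the two ranges, which partition the index type, and each partial
  sum is reindexed by its injection. The result is a single sum of paired terms, because the image
  sum in the hypothesis is itself a sum of pairs.\<close>

lemma infsum_split_range:
  fixes f :: "'b \<Rightarrow> 'c::banach"
  assumes "f summable_on UNIV" "inj g" "inj h" "range g \<inter> range h = {}" "range g \<union> range h = UNIV"
  shows "infsum f UNIV = (\<Sum>\<^sub>\<infinity>x. f (g x) + f (h x))"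
proof -
  have s: "f summable_on range g" "f summable_on range h"
    using assms(1) summable_on_subset_banach by blast+
  have s': "(\<lambda>x. f (g x)) summable_on UNIV" "(\<lambda>x. f (h x)) summable_on UNIV"
    using s assms(2,3) by (simp_all add: summable_on_reindex o_def)
  have "infsum f UNIV = infsum f (range g) + infsum f (range h)"
    using infsum_Un_disjoint[OF s assms(4)] assms(5) by simp
  also have "\<dots> = (\<Sum>\<^sub>\<infinity>x. f (g x) + f (h x))"
    using assms(2,3) s' by (simp add: infsum_reindex o_def infsum_add)
  finally show ?thesis .
qed

text \<open>Even and odd indices will correspond to the two families of images, which the hypothesis
  combines under one summation index.\<close>

lemma infsum_int_even_odd:
  fixes f :: "int \<Rightarrow> 'c::banach"
  assumes "f summable_on UNIV"
  shows "infsum f UNIV = (\<Sum>\<^sub>\<infinity>n. f (2 * n) + f (2 * n + 1))"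
proof (rule infsum_split_range[OF assms])
  show "range ((*) (2::int)) \<inter> range (\<lambda>n. 2 * n + 1) = {}"
    by (auto; presburger)
  have "n \<in> range ((*) 2) \<union> range (\<lambda>n. 2 * n + 1)" for n :: int
    by (cases "even n") (auto elim: evenE oddE)
  then show "range ((*) (2::int)) \<union> range (\<lambda>n. 2 * n + 1) = UNIV"
    by blast
qed (auto intro: injI)

text \<open>The reflection \<open>- 1 - n\<close> has no fixed integer and exchanges the nonnegative
  with the negative integers. It is also the symmetry of \<open>n + 1/2\<close> up to sign, so it
  suits sums over half-integers.\<close>

lemma infsum_int_nonneg_neg:
  fixes f :: "int \<Rightarrow> 'c::banach"
  assumes "f summable_on UNIV"
  shows "infsum f UNIV = (\<Sum>\<^sub>\<infinity>k. f (int k) + f (- 1 - int k))"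
proof (rule infsum_split_range[OF assms])
  have "n \<in> range int \<union> range (\<lambda>k. - 1 - int k)" for n :: int
  proof (cases "n \<ge> 0")
    case True
    then have "n = int (nat n)" by simp
    then show ?thesis by blast
  next
    case False
    then have "n = - 1 - int (nat (- 1 - n))" by simp
    then show ?thesis by blast
  qed
  then show "range int \<union> range (\<lambda>k. - 1 - int k) = UNIV"
    by blast
qed (auto intro: injI)

section \<open>Gaussian majorants over the integers\<close>

text \<open>Two geometric series with ratio \<open>exp (- 1)\<close> cover the integers. Their
  ranges overlap at 0, which is harmless since only summability is claimed.\<close>

lemma summable_on_exp_minus_abs_int: "(\<lambda>n::int. exp (- \<bar>real_of_int n\<bar>)) summable_on UNIV"
proof -
  have "summable (\<lambda>k::nat. exp (- 1::real) ^ k)"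
    by (rule summable_geometric) simp
  then have nat: "(\<lambda>k::nat. exp (- real k)) summable_on UNIV"
    by (intro norm_summable_imp_summable_on) (simp flip: exp_of_nat_mult)
  have "(\<lambda>n::int. exp (- \<bar>real_of_int n\<bar>)) summable_on range int"
    using nat by (subst summable_on_reindex) (auto simp: o_def)
  moreover have "(\<lambda>n::int. exp (- \<bar>real_of_int n\<bar>)) summable_on range (\<lambda>k. - int k)"
    using nat by (subst summable_on_reindex) (auto simp: o_def inj_def)
  moreover have "range int \<union> range (\<lambda>k. - int k) = UNIV"
    by (auto intro: int_cases2)
  ultimately show ?thesis
    using summable_on_union by metis
qed

text \<open>The quadratic term dominates any linear one, so the family is bounded by a constant
  times \<open>exp (- \<bar>n\<bar>)\<close>. The constants \<open>B\<close> and \<open>D\<close>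
  leave room for linear and constant terms of the exponent that vary over a compact set.\<close>

lemma summable_on_gaussian_int:
  fixes a B D :: real
  assumes "a > 0"
  shows "(\<lambda>n::int. exp (- a * (real_of_int n)\<^sup>2 + B * \<bar>real_of_int n\<bar> + D)) summable_on UNIV"
proof (rule summable_on_comparison_test)
  show "(\<lambda>n::int. exp ((B + 1)\<^sup>2 / (4 * a) + D) * exp (- \<bar>real_of_int n\<bar>)) summable_on UNIV"
    by (intro summable_on_cmult_right summable_on_exp_minus_abs_int)
  have "- a * x\<^sup>2 + B * \<bar>x\<bar> \<le> (B + 1)\<^sup>2 / (4 * a) - \<bar>x\<bar>" for x
  proof -
    \<comment> \<open>Completing the square for the coefficient \<open>B + 1\<close> instead of
      \<open>B\<close> leaves a spare \<open>- \<bar>x\<bar>\<close> for the decay.\<close>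
    have "0 \<le> a * (\<bar>x\<bar> - (B + 1) / (2 * a))\<^sup>2"
      using assms by simp
    also have "\<dots> = a * x\<^sup>2 - (B + 1) * \<bar>x\<bar> + (B + 1)\<^sup>2 / (4 * a)"
      using assms by (simp add: power2_eq_square field_simps)
    finally show ?thesis
      by (simp add: algebra_simps)
  qed
  from this[of "real_of_int _"]
  show "exp (- a * (real_of_int n)\<^sup>2 + B * \<bar>real_of_int n\<bar> + D)
      \<le> exp ((B + 1)\<^sup>2 / (4 * a) + D) * exp (- \<bar>real_of_int n\<bar>)" for n
    by (smt (verit) exp_add exp_le_cancel_iff)
qed simp

section \<open>Entire functions defined by series\<close>

text \<open>By the Weierstrass M-test the finite partial sums converge uniformly on every disc, and
  uniform limits of holomorphic functions are holomorphic. The majorant may depend on the radius,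
  since differentiability is a local matter.\<close>

lemma holomorphic_on_infsum:
  fixes f :: "'i \<Rightarrow> complex \<Rightarrow> complex"
  assumes "\<And>n. n \<in> A \<Longrightarrow> f n holomorphic_on UNIV"
    and bound: "\<And>R. \<exists>M. M summable_on A \<and> (\<forall>n\<in>A. \<forall>z\<in>cball 0 R. norm (f n z) \<le> M n)"
  shows "(\<lambda>z. \<Sum>\<^sub>\<infinity>n\<in>A. f n z) holomorphic_on UNIV"
proof -
  have hol: "(\<lambda>z. \<Sum>\<^sub>\<infinity>n\<in>A. f n z) holomorphic_on ball 0 R" for R
  proof -
    obtain M where M: "M summable_on A" "\<And>n z. n \<in> A \<Longrightarrow> z \<in> cball 0 R \<Longrightarrow> norm (f n z) \<le> M n"
      using bound by metis
    have "\<forall>\<^sub>F X in finite_subsets_at_top A. continuous_on (cball 0 R) (\<lambda>z. \<Sum>n\<in>X. f n z) \<and>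
        (\<lambda>z. \<Sum>n\<in>X. f n z) holomorphic_on ball 0 R"
    proof (rule eventually_finite_subsets_at_top_weakI)
      fix X assume "finite X" "X \<subseteq> A"
      then have "(\<lambda>z. \<Sum>n\<in>X. f n z) holomorphic_on UNIV"
        using assms(1) by (intro holomorphic_on_sum) auto
      then show "continuous_on (cball 0 R) (\<lambda>z. \<Sum>n\<in>X. f n z) \<and>
        (\<lambda>z. \<Sum>n\<in>X. f n z) holomorphic_on ball 0 R"
        by (meson holomorphic_on_imp_continuous_on holomorphic_on_subset subset_UNIV)
    qed
    moreover have "uniform_limit (cball 0 R) (\<lambda>X z. \<Sum>n\<in>X. f n z) (\<lambda>z. \<Sum>\<^sub>\<infinity>n\<in>A. f n z)
        (finite_subsets_at_top A)"
      using M by (intro Weierstrass_m_test_general)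
    ultimately show ?thesis
      using holomorphic_uniform_limit finite_subsets_at_top_neq_bot by metis
  qed
  \<comment> \<open>The radius \<open>norm z + 1\<close> places \<open>z\<close> inside an open
    disc, where holomorphy gives a derivative at \<open>z\<close>.\<close>
  have "\<exists>f'. ((\<lambda>z. \<Sum>\<^sub>\<infinity>n\<in>A. f n z) has_field_derivative f') (at z)" for z
    using hol[of "norm z + 1"] by (simp add: holomorphic_on_open)
  then show ?thesis
    by (simp add: holomorphic_on_open)
qed

text \<open>Both sides of the identity are series of this shape: bounded coefficients and an
  exponent quadratic in \<open>n\<close>, in which only the lower-order coefficients depend on
  \<open>z\<close>. These are entire, hence bounded on each disc, so a single Gaussian majorant
  serves the whole disc.\<close>

lemma
  fixes a :: real and b d :: "complex \<Rightarrow> complex" and s :: "int \<Rightarrow> complex"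
  assumes a: "a > 0" and hol: "b holomorphic_on UNIV" "d holomorphic_on UNIV"
    and s: "\<And>n. norm (s n) \<le> 1"
  shows summable_on_gaussian_series:
      "(\<lambda>n. s n * exp (- of_real a * (of_int n)\<^sup>2 + b z * of_int n + d z)) summable_on UNIV"
    and holomorphic_on_gaussian_series:
      "(\<lambda>z. \<Sum>\<^sub>\<infinity>n. s n * exp (- of_real a * (of_int n)\<^sup>2 + b z * of_int n + d z)) holomorphic_on UNIV"
proof -
  let ?f = "\<lambda>n z. s n * exp (- of_real a * (of_int n)\<^sup>2 + b z * of_int n + d z)"
  have bound: "\<exists>M. M summable_on UNIV \<and> (\<forall>n. \<forall>z\<in>cball 0 R. norm (?f n z) \<le> M n)" for R
  proof -
    have "bounded (g ` cball 0 R)" if "g holomorphic_on UNIV" for g :: "complex \<Rightarrow> complex"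
      using that by (meson compact_cball compact_continuous_image compact_imp_bounded
          holomorphic_on_imp_continuous_on holomorphic_on_subset subset_UNIV)
    then obtain B D where BD: "\<And>z. z \<in> cball 0 R \<Longrightarrow> norm (b z) \<le> B" "\<And>z. z \<in> cball 0 R \<Longrightarrow> norm (d z) \<le> D"
      using hol unfolding bounded_iff by (metis imageI)
    have "norm (?f n z) \<le> exp (- a * (real_of_int n)\<^sup>2 + B * \<bar>real_of_int n\<bar> + D)"
      if z: "z \<in> cball 0 R" for n z
    proof -
      have "Re (b z * of_int n) \<le> norm (b z) * \<bar>real_of_int n\<bar>"
        by (metis complex_Re_le_cmod norm_mult norm_of_int)
      also have "\<dots> \<le> B * \<bar>real_of_int n\<bar>"
        by (intro mult_right_mono BD z) simp
      finally have "Re (b z * of_int n) \<le> B * \<bar>real_of_int n\<bar>" .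
      moreover have "Re (d z) \<le> D"
        using BD(2)[OF z] complex_Re_le_cmod order_trans by blast
      moreover have "Re (- of_real a * (of_int n)\<^sup>2) = - a * (real_of_int n)\<^sup>2"
        by (simp add: power2_eq_square)
      ultimately have "norm (exp (- of_real a * (of_int n)\<^sup>2 + b z * of_int n + d z))
          \<le> exp (- a * (real_of_int n)\<^sup>2 + B * \<bar>real_of_int n\<bar> + D)"
        unfolding norm_exp_eq_Re exp_le_cancel_iff plus_complex.sel by linarith
      then show ?thesis
        using s[of n] mult_mono[of "norm (s n)" 1] by (fastforce simp: norm_mult)
    qed
    then show ?thesis
      using summable_on_gaussian_int[OF a] by blast
  qed
  show "(\<lambda>n. ?f n z) summable_on UNIV"
  proof -
    obtain M where M: "M summable_on UNIV" "\<And>n. norm (?f n z) \<le> M n"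
      using bound[of "norm z"] by auto
    then have "(\<lambda>n. norm (?f n z)) summable_on UNIV"
      by (rule summable_on_comparison_test) auto
    then show ?thesis
      by (rule abs_summable_summable)
  qed
  show "(\<lambda>z. \<Sum>\<^sub>\<infinity>n. ?f n z) holomorphic_on UNIV"
    using bound by (intro holomorphic_on_infsum) (auto intro!: holomorphic_intros hol)
qed

section \<open>Symmetrization, and passage from complex to real sums\<close>

text \<open>Reindexing by a bijection preserves the sum, hence so does averaging with the reindexed
  family. With a reflection as \<open>g\<close> this turns exponentials into \<open>cos\<close> or
  \<open>cosh\<close>.\<close>

lemma has_sum_symmetrize:
  fixes f :: "int \<Rightarrow> complex"
  assumes "f summable_on UNIV" "bij g"
  shows "((\<lambda>n. (f n + f (g n)) / 2) has_sum infsum f UNIV) UNIV"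
proof -
  have "(f has_sum infsum f UNIV) UNIV"
    using assms(1) by simp
  moreover from this have "((\<lambda>n. f (g n)) has_sum infsum f UNIV) UNIV"
    using has_sum_reindex_bij_betw assms(2) by blast
  ultimately have "((\<lambda>n. (f n + f (g n)) * (1 / 2)) has_sum (infsum f UNIV + infsum f UNIV) * (1 / 2)) UNIV"
    by (intro has_sum_cmult_left has_sum_add)
  then show ?thesis
    by simp
qed

text \<open>Taking real parts transfers summability. This brings the complex series at a real
  argument down to the real series of the hypothesis.\<close>

lemma infsum_of_real_complex:
  fixes f :: "'i \<Rightarrow> real"
  assumes "(\<lambda>x. complex_of_real (f x)) summable_on A"
  shows "(f has_sum infsum f A) A" "(\<Sum>\<^sub>\<infinity>x\<in>A. complex_of_real (f x)) = of_real (infsum f A)"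
proof -
  show f: "(f has_sum infsum f A) A"
    using summable_on_Re[OF assms] by simp
  show "(\<Sum>\<^sub>\<infinity>x\<in>A. complex_of_real (f x)) = of_real (infsum f A)"
    by (intro infsumI has_sum_of_real f)
qed

section \<open>The spectral and image series in exponential form\<close>

context
  fixes t :: real
  assumes t: "t > 0"
begin

text \<open>One exponential half of the cosine term: averaging the indices \<open>n\<close> and
  \<open>- 1 - n\<close> gives the cosine. A single exponential fits the general Gaussian series
  directly.\<close>

definition spectral_exp :: "complex \<Rightarrow> int \<Rightarrow> complex"
  where "spectral_exp z n = exp (- complex_of_real (pi * t * (real_of_int n + 1 / 2)\<^sup>2) + \<i> * (2 * of_int n + 1) * z)"

text \<open>For real \<open>z\<close> this is the contribution of an image source at
  \<open>- pi * n\<close>: even \<open>n\<close> are translates of the source, odd \<open>n\<close>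
  are reflections and carry the minus sign.\<close>

definition image_exp :: "complex \<Rightarrow> int \<Rightarrow> complex"
  where "image_exp z n = (- 1) powi n * exp (- ((z + complex_of_real pi * of_int n)\<^sup>2 / complex_of_real (pi * t)))"

text \<open>Expanding the square gives the shape of the general Gaussian series; the factor
  \<open>1\<close> stands for the coefficient \<open>s n\<close>.\<close>

lemma spectral_exp_gaussian:
  "spectral_exp z n = 1 * exp (- of_real (pi * t) * (of_int n)\<^sup>2 + (2 * \<i> * z - of_real (pi * t)) * of_int n
     + (\<i> * z - of_real (pi * t / 4)))"
  unfolding spectral_exp_def by (simp add: power2_eq_square field_simps)

lemma image_exp_gaussian:
  "image_exp z n = (- 1) powi n * exp (- of_real (pi / t) * (of_int n)\<^sup>2 + (- 2 * z / of_real t) * of_int n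
     + - z\<^sup>2 / of_real (pi * t))"
proof -
  have "- ((z + complex_of_real pi * of_int n)\<^sup>2 / complex_of_real (pi * t)) =
      - of_real (pi / t) * (of_int n)\<^sup>2 + (- 2 * z / of_real t) * of_int n + - z\<^sup>2 / of_real (pi * t)"
    using t by (simp add: power2_eq_square divide_simps) (simp add: algebra_simps)
  then show ?thesis
    unfolding image_exp_def by simp
qed

lemma summable_on_spectral_exp: "spectral_exp z summable_on UNIV"
  unfolding spectral_exp_gaussian[abs_def]
  by (rule summable_on_gaussian_series[of "pi * t" "\<lambda>z. 2 * \<i> * z - of_real (pi * t)"
        "\<lambda>z. \<i> * z - of_real (pi * t / 4)" "\<lambda>_. 1" z])
     (use t in \<open>auto intro!: holomorphic_intros\<close>)

lemma summable_on_image_exp: "image_exp z summable_on UNIV"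
  unfolding image_exp_gaussian[abs_def]
  by (rule summable_on_gaussian_series[of "pi / t" "\<lambda>z. - 2 * z / of_real t" "\<lambda>z. - z\<^sup>2 / of_real (pi * t)"
        "\<lambda>n. (- 1) powi n" z])
     (use t in \<open>auto intro!: holomorphic_intros simp: norm_power_int\<close>)

lemma holomorphic_on_infsum_spectral_exp: "(\<lambda>z. infsum (spectral_exp z) UNIV) holomorphic_on UNIV"
  unfolding spectral_exp_gaussian[abs_def]
  by (rule holomorphic_on_gaussian_series[of "pi * t" "\<lambda>z. 2 * \<i> * z - of_real (pi * t)"
        "\<lambda>z. \<i> * z - of_real (pi * t / 4)" "\<lambda>_. 1"])
     (use t in \<open>auto intro!: holomorphic_intros\<close>)

lemma holomorphic_on_infsum_image_exp: "(\<lambda>z. infsum (image_exp z) UNIV) holomorphic_on UNIV"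
  unfolding image_exp_gaussian[abs_def]
  by (rule holomorphic_on_gaussian_series[of "pi / t" "\<lambda>z. - 2 * z / of_real t" "\<lambda>z. - z\<^sup>2 / of_real (pi * t)"
        "\<lambda>n. (- 1) powi n"])
     (use t in \<open>auto intro!: holomorphic_intros simp: norm_power_int\<close>)

text \<open>The reflection \<open>- 1 - n\<close> preserves \<open>(n + 1/2)^2\<close> and negates
  \<open>2 * n + 1\<close>, so averaging over it produces the cosine by Euler's formula.\<close>

lemma has_sum_spectral_cos:
  "((\<lambda>n. complex_of_real (exp (- pi * t * (real_of_int n + 1 / 2)\<^sup>2)) * cos ((2 * of_int n + 1) * z))
     has_sum infsum (spectral_exp z) UNIV) UNIV"
proof -
  have "(spectral_exp z n + spectral_exp z (- 1 - n)) / 2 =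
      complex_of_real (exp (- pi * t * (real_of_int n + 1 / 2)\<^sup>2)) * cos ((2 * of_int n + 1) * z)" for n
  proof -
    have "real_of_int (- 1 - n) + 1 / 2 = - (real_of_int n + 1 / 2)"
      by simp
    then have "(real_of_int (- 1 - n) + 1 / 2)\<^sup>2 = (real_of_int n + 1 / 2)\<^sup>2"
      by (metis power2_minus)
    moreover have "\<i> * (2 * of_int (- 1 - n) + 1) * z = - (\<i> * ((2 * of_int n + 1) * z))"
      by (simp add: algebra_simps)
    ultimately show ?thesis
      unfolding spectral_exp_def cos_exp_eq exp_add
      by (simp add: exp_of_real[symmetric] algebra_simps del: exp_of_real)
  qed
  moreover have "bij (\<lambda>n::int. - 1 - n)"
    by (rule bij_betw_byWitness[where f' = "\<lambda>n. - 1 - n"]) auto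
  ultimately show ?thesis
    using has_sum_symmetrize[OF summable_on_spectral_exp, of "\<lambda>n. - 1 - n" z] by simp
qed

text \<open>The prefactor removes the part of the expanded square that is free of \<open>n\<close>.
  What remains is a Gaussian in \<open>n\<close> times \<open>exp (- 2 * n * z / t)\<close>, and
  averaging over \<open>n\<close> and \<open>- n\<close> gives \<open>cosh\<close>, the sign being
  even in \<open>n\<close>.\<close>

lemma has_sum_image_cosh:
  "((\<lambda>n. (- 1) powi n * complex_of_real (exp (- pi * (real_of_int n)\<^sup>2 / t)) * cosh (2 * of_int n * (z / complex_of_real t)))
     has_sum exp (z\<^sup>2 / complex_of_real (pi * t)) * infsum (image_exp z) UNIV) UNIV"
proof -
  have "exp (z\<^sup>2 / complex_of_real (pi * t)) * ((image_exp z n + image_exp z (- n)) / 2) =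
      (- 1) powi n * complex_of_real (exp (- pi * (real_of_int n)\<^sup>2 / t)) * cosh (2 * of_int n * (z / complex_of_real t))" for n
  proof -
    have "exp (z\<^sup>2 / complex_of_real (pi * t)) * image_exp z m =
        (- 1) powi m * complex_of_real (exp (- pi * (real_of_int m)\<^sup>2 / t)) * exp (- (2 * of_int m * (z / complex_of_real t)))" for m
    proof -
      have "exp (z\<^sup>2 / complex_of_real (pi * t)) * exp (- of_real (pi / t) * (of_int m)\<^sup>2 + (- 2 * z / t) * of_int m - z\<^sup>2 / (pi * t)) =
         exp (- complex_of_real (pi / t) * (of_int m)\<^sup>2) * exp (- (2 * of_int m * (z / complex_of_real t)))"
        by (simp add: mult_exp_exp algebra_simps)
      also have "exp (- complex_of_real (pi / t) * (of_int m)\<^sup>2) = complex_of_real (exp (- pi * (real_of_int m)\<^sup>2 / t))"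
        by (simp flip: exp_of_real)
      finally show ?thesis
        unfolding image_exp_gaussian by (simp add: mult.assoc mult.left_commute)
    qed
    from this[of n] this[of "- n"] show ?thesis
      by (simp add: cosh_field_def distrib_left add_divide_distrib power_int_minus flip: power_int_inverse)
  qed
  moreover have "bij (uminus :: int \<Rightarrow> int)"
    by (rule bij_uminus)
  ultimately show ?thesis
    using has_sum_cmult_right[OF has_sum_symmetrize[OF summable_on_image_exp, of uminus z], of "exp (z\<^sup>2 / complex_of_real (pi * t))"]
    by simp
qed

end

section \<open>The spectral side at y = 0\<close>

text \<open>The arguments are \<open>(2 * k + 1) * x\<close> shifted by
  \<open>k * pi + pi / 2\<close>, and that shift alone. Since the shift has cosine 0 and sine
  \<open>(- 1) ^ k\<close>, each factor contributes this sign and the two signs cancel.\<close>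

lemma sin_odd_pi_half_mult_sin:
  "sin (real (2 * k + 1) * pi * (2 * x / pi + 1) / 2) * sin (real (2 * k + 1) * pi * (0 + 1) / 2) =
     cos ((2 * real k + 1) * x)"
proof -
  have sgn: "sin (real k * pi + pi / 2) = (- 1) ^ k"
    using sin_npi2 by (simp add: sin_add)
  have eq1: "real (2 * k + 1) * pi * (2 * x / pi + 1) / 2 = (2 * real k + 1) * x + (real k * pi + pi / 2)"
    by (simp add: field_simps)
  have eq2: "real (2 * k + 1) * pi * (0 + 1) / 2 = real k * pi + pi / 2"
    by (simp add: field_simps)
  have "cos (real k * pi + pi / 2) = 0"
    by (simp add: cos_add)
  then have "sin ((2 * real k + 1) * x + (real k * pi + pi / 2)) = cos ((2 * real k + 1) * x) * (- 1) ^ k"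
    unfolding sin_add[of "(2 * real k + 1) * x"] sgn by simp
  then show ?thesis
    unfolding eq1 eq2 sgn by (simp flip: power_add mult_2)
qed

text \<open>At y = 0 the second sine is \<open>sin (n * pi / 2)\<close>, which vanishes for even
  \<open>n\<close>; the remaining indices are \<open>2 * k + 1\<close> with \<open>k\<close>
  starting at 0.\<close>

lemma infsum_odd_sines:
  fixes c :: "nat \<Rightarrow> real"
  shows "(\<Sum>\<^sub>\<infinity>n\<in>{1::nat..}. c n * sin (real n * pi * (2 * x / pi + 1) / 2) * sin (real n * pi * (0 + 1) / 2)) =
    (\<Sum>\<^sub>\<infinity>k. c (2 * k + 1) * cos ((2 * real k + 1) * x))"
proof -
  let ?g = "\<lambda>n. c n * sin (real n * pi * (2 * x / pi + 1) / 2) * sin (real n * pi * (0 + 1) / 2)"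
  have "sin (real n * pi * (0 + 1) / 2) = 0" if "even n" for n
    using that by (auto elim!: evenE)
  moreover have "n \<in> range (\<lambda>k. 2 * k + 1)" if "odd n" for n :: nat
    using that by (auto elim!: oddE)
  ultimately have "infsum ?g {1..} = infsum ?g (range (\<lambda>k. 2 * k + 1))"
    by (intro infsum_cong_neutral) auto
  also have "\<dots> = (\<Sum>\<^sub>\<infinity>k. ?g (2 * k + 1))"
    by (subst infsum_reindex) (auto simp: inj_def o_def)
  also have "\<dots> = (\<Sum>\<^sub>\<infinity>k. c (2 * k + 1) * cos ((2 * real k + 1) * x))"
    by (simp only: mult.assoc[of "c _"] sin_odd_pi_half_mult_sin)
  finally show ?thesis .
qed

section \<open>The identity on the real line and its analytic continuation\<close>

theorem theorem4p2:
  assumes spectral_representation: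
    "\<forall>(x::real) (y::real) (t::real). t > 0 \<longrightarrow>
       1 / 2 * (1 / sqrt (2 * pi * t)) *
         (\<Sum>\<^sub>\<infinity>n\<in>(UNIV :: int set).
            exp (- ((x - y + 4 * real_of_int n)\<^sup>2 / (2 * t)))
            - exp (- ((x + y + 4 * real_of_int n + 2)\<^sup>2 / (2 * t))))
       = 1 / 2 * (\<Sum>\<^sub>\<infinity>n\<in>{1 :: nat..}.
            exp (- ((real n)\<^sup>2 * pi\<^sup>2 / 8) * t)
            * sin (real n * pi * (x + 1) / 2) * sin (real n * pi * (y + 1) / 2))"
  shows
    "\<forall>(t::real) (z::complex). t > 0 \<longrightarrow>
       (\<lambda>n::int. complex_of_real (exp (- pi * t * (real_of_int n + 1 / 2)\<^sup>2))
          * cos ((2 * of_int n + 1) * z)) summable_on UNIV \<and>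
       (\<lambda>n::int. (- 1) powi n * complex_of_real (exp (- pi * (real_of_int n)\<^sup>2 / t))
          * cosh (2 * of_int n * (z / complex_of_real t))) summable_on UNIV \<and>
       (\<lambda>n::int. (- 1) powi n
          * exp (- ((z + complex_of_real pi * of_int n)\<^sup>2 / complex_of_real (pi * t)))) summable_on UNIV \<and>
       complex_of_real (sqrt t) *
         (\<Sum>\<^sub>\<infinity>n\<in>(UNIV :: int set).
            complex_of_real (exp (- pi * t * (real_of_int n + 1 / 2)\<^sup>2))
            * cos ((2 * of_int n + 1) * z))
       = exp (- (z\<^sup>2 / complex_of_real (pi * t))) *
         (\<Sum>\<^sub>\<infinity>n\<in>(UNIV :: int set).
            (- 1) powi n * complex_of_real (exp (- pi * (real_of_int n)\<^sup>2 / t))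
            * cosh (2 * of_int n * (z / complex_of_real t))) \<and>
       exp (- (z\<^sup>2 / complex_of_real (pi * t))) *
         (\<Sum>\<^sub>\<infinity>n\<in>(UNIV :: int set).
            (- 1) powi n * complex_of_real (exp (- pi * (real_of_int n)\<^sup>2 / t))
            * cosh (2 * of_int n * (z / complex_of_real t)))
       = (\<Sum>\<^sub>\<infinity>n\<in>(UNIV :: int set).
            (- 1) powi n
            * exp (- ((z + complex_of_real pi * of_int n)\<^sup>2 / complex_of_real (pi * t))))"
proof -
  have real_identity: "sqrt t * infsum (spectral_exp t x) UNIV = infsum (image_exp t x) UNIV"
    if t: "t > 0" for t x :: real
  proof -
    define A where "A n = (- 1) powi n * exp (- ((x + pi * real_of_int n)\<^sup>2 / (pi * t)))" for n :: int
    define B where "B n = exp (- pi * t * (real_of_int n + 1 / 2)\<^sup>2) * cos ((2 * real_of_int n + 1) * x)" for n :: int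
    have A: "image_exp t x n = complex_of_real (A n)" for n
      unfolding image_exp_def[OF t] A_def by (simp flip: exp_of_real)
    have B: "complex_of_real (exp (- pi * t * (real_of_int n + 1 / 2)\<^sup>2)) * cos ((2 * of_int n + 1) * complex_of_real x) =
        complex_of_real (B n)" for n
      unfolding B_def by (simp flip: cos_of_real)
    \<comment> \<open>Actual summability is recorded beside the values, because an
      \<open>infsum\<close> defaults to 0 otherwise and splitting it would not be justified.\<close>
    have sumA: "(A has_sum infsum A UNIV) UNIV" and infA: "infsum (image_exp t x) UNIV = infsum A UNIV"
      using infsum_of_real_complex[of A UNIV] summable_on_image_exp[OF t, of x] unfolding A[abs_def] by simp_all
    have sumB: "(B has_sum infsum B UNIV) UNIV" and infB: "infsum (spectral_exp t x) UNIV = infsum B UNIV"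
      using infsum_of_real_complex[of B UNIV] has_sum_spectral_cos[OF t, of x] unfolding B has_sum_iff by simp_all
    \<comment> \<open>This time makes \<open>(2 * k + 1)^2 * pi^2 / 8 * T\<close> equal to
      \<open>pi * t * (k + 1/2)^2\<close>. Together with the position \<open>2 * x / pi\<close> it
      also turns the image exponents into \<open>(x + pi * m)^2 / (pi * t)\<close>.\<close>
    define T where "T = 2 * t / pi"
    have "T > 0" unfolding T_def using t by simp
    note * = spectral_representation[rule_format, OF this, of "2 * x / pi" 0]
    \<comment> \<open>The shifts \<open>4 * n\<close> and \<open>4 * n + 2\<close> are
      \<open>2 * m\<close> with \<open>m = 2 * n\<close> and \<open>m = 2 * n + 1\<close>; the minus
      sign of the second family is the sign of the odd index.\<close>
    have "exp (- ((2 * x / pi - 0 + 4 * real_of_int n)\<^sup>2 / (2 * T))) - exp (- ((2 * x / pi + 0 + 4 * real_of_int n + 2)\<^sup>2 / (2 * T)))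
        = A (2 * n) + A (2 * n + 1)" for n
    proof -
      have "(2 * x / pi + 2 * y)\<^sup>2 / (2 * T) = (x + pi * y)\<^sup>2 / (pi * t)" for y
        unfolding T_def using t by (simp add: power2_eq_square field_simps)
      from this[of "2 * real_of_int n"] this[of "2 * real_of_int n + 1"] show ?thesis
        unfolding A_def by (simp add: power_int_add algebra_simps)
    qed
    moreover have "exp (- ((real (2 * k + 1))\<^sup>2 * pi\<^sup>2 / 8) * T) * cos ((2 * real k + 1) * x) = B (int k)" for k
    proof -
      have "- ((real (2 * k + 1))\<^sup>2 * pi\<^sup>2 / 8) * T = - pi * t * (real_of_int (int k) + 1 / 2)\<^sup>2"
        unfolding T_def by (simp add: power2_eq_square field_simps)
      then show ?thesis
        unfolding B_def by simp
    qed
    ultimately have "1 / sqrt (2 * pi * T) * infsum A UNIV = (\<Sum>\<^sub>\<infinity>k. B (int k))"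
      using * unfolding infsum_odd_sines infsum_int_even_odd[OF has_sum_imp_summable[OF sumA]] by simp
    moreover have "sqrt (2 * pi * T) = 2 * sqrt t"
      unfolding T_def by (simp add: real_sqrt_mult)
    \<comment> \<open>By this symmetry the sum over all integers is twice the sum over
      \<open>k\<close> from 0, and this 2 cancels the one in
      \<open>sqrt (2 * pi * T) = 2 * sqrt t\<close>.\<close>
    moreover have "B (- 1 - int k) = B (int k)" for k
    proof -
      have "real_of_int (- 1 - int k) + 1 / 2 = - (real_of_int (int k) + 1 / 2)"
        by simp
      then have "(real_of_int (- 1 - int k) + 1 / 2)\<^sup>2 = (real_of_int (int k) + 1 / 2)\<^sup>2"
        by (metis power2_minus)
      moreover have "(2 * real_of_int (- 1 - int k) + 1) * x = - ((2 * real_of_int (int k) + 1) * x)"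
        by (simp add: algebra_simps)
      ultimately show ?thesis
        unfolding B_def by simp
    qed
    then have "infsum B UNIV = (\<Sum>\<^sub>\<infinity>k. 2 * B (int k))"
      unfolding infsum_int_nonneg_neg[OF has_sum_imp_summable[OF sumB]] by simp
    then have "infsum B UNIV = 2 * (\<Sum>\<^sub>\<infinity>k. B (int k))"
      by (simp add: infsum_cmult_right')
    ultimately have "sqrt t * infsum B UNIV = infsum A UNIV"
      using t by (simp add: field_simps)
    then show ?thesis
      unfolding infA infB by (metis of_real_mult)
  qed
  have identity: "sqrt t * infsum (spectral_exp t z) UNIV = infsum (image_exp t z) UNIV"
    if t: "t > 0" for t :: real and z :: complex
  proof -
    have "(\<lambda>z. sqrt t * infsum (spectral_exp t z) UNIV - infsum (image_exp t z) UNIV) holomorphic_on UNIV"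
      by (intro holomorphic_intros holomorphic_on_infsum_spectral_exp holomorphic_on_infsum_image_exp t)
    \<comment> \<open>The identity theorem requires an accumulation point of zeros: the difference
      of the two sides vanishes on the real line, and the points \<open>e / 2\<close> approach
      0.\<close>
    moreover have "0 islimpt (\<real> :: complex set)"
    proof (unfold islimpt_approachable, intro allI impI)
      fix e :: real assume "e > 0"
      then show "\<exists>x'\<in>\<real>. x' \<noteq> 0 \<and> dist x' (0::complex) < e"
        by (intro bexI[of _ "complex_of_real (e / 2)"]) auto
    qed
    moreover have "sqrt t * infsum (spectral_exp t w) UNIV - infsum (image_exp t w) UNIV = 0" if "w \<in> \<real>" for w
      using that real_identity[OF t] by (auto elim!: Reals_cases)
    ultimately have "sqrt t * infsum (spectral_exp t z) UNIV - infsum (image_exp t z) UNIV = 0"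
      using analytic_continuation[of "\<lambda>z. sqrt t * infsum (spectral_exp t z) UNIV - infsum (image_exp t z) UNIV" UNIV \<real> 0 z]
      by (simp add: convex_connected)
    then show ?thesis
      by simp
  qed
  show ?thesis
  proof (intro allI impI)
    fix t :: real and z :: complex
    assume t: "t > 0"
    note F = has_sum_spectral_cos[OF t, of z] and C = has_sum_image_cosh[OF t, of z]
    have S: "image_exp t z = (\<lambda>n. (- 1) powi n * exp (- ((z + complex_of_real pi * of_int n)\<^sup>2 / complex_of_real (pi * t))))"
      by (rule ext) (rule image_exp_def[OF t])
    \<comment> \<open>After this cancellation the \<open>cosh\<close> expression is exactly the sum
      of \<open>image_exp\<close>, so the first equality becomes \<open>identity\<close> and the
      second holds by reflexivity.\<close>
    have cancel: "exp (- (z\<^sup>2 / complex_of_real (pi * t))) * (exp (z\<^sup>2 / complex_of_real (pi * t)) * w) = w" for w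
      by (simp add: mult_exp_exp flip: mult.assoc)
    show "(\<lambda>n::int. complex_of_real (exp (- pi * t * (real_of_int n + 1 / 2)\<^sup>2))
          * cos ((2 * of_int n + 1) * z)) summable_on UNIV \<and>
       (\<lambda>n::int. (- 1) powi n * complex_of_real (exp (- pi * (real_of_int n)\<^sup>2 / t))
          * cosh (2 * of_int n * (z / complex_of_real t))) summable_on UNIV \<and>
       (\<lambda>n::int. (- 1) powi n
          * exp (- ((z + complex_of_real pi * of_int n)\<^sup>2 / complex_of_real (pi * t)))) summable_on UNIV \<and>
       complex_of_real (sqrt t) *
         (\<Sum>\<^sub>\<infinity>n\<in>(UNIV :: int set).
            complex_of_real (exp (- pi * t * (real_of_int n + 1 / 2)\<^sup>2))
            * cos ((2 * of_int n + 1) * z))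
       = exp (- (z\<^sup>2 / complex_of_real (pi * t))) *
         (\<Sum>\<^sub>\<infinity>n\<in>(UNIV :: int set).
            (- 1) powi n * complex_of_real (exp (- pi * (real_of_int n)\<^sup>2 / t))
            * cosh (2 * of_int n * (z / complex_of_real t))) \<and>
       exp (- (z\<^sup>2 / complex_of_real (pi * t))) *
         (\<Sum>\<^sub>\<infinity>n\<in>(UNIV :: int set).
            (- 1) powi n * complex_of_real (exp (- pi * (real_of_int n)\<^sup>2 / t))
            * cosh (2 * of_int n * (z / complex_of_real t)))
       = (\<Sum>\<^sub>\<infinity>n\<in>(UNIV :: int set).
            (- 1) powi n
            * exp (- ((z + complex_of_real pi * of_int n)\<^sup>2 / complex_of_real (pi * t))))"
      unfolding infsumI[OF F] infsumI[OF C] cancel S[symmetric]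
      using F C summable_on_image_exp[OF t, of z] identity[OF t, of z]
      by (auto intro: has_sum_imp_summable)
  qed
qed

end
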